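(* Let $\eta$ and $\beta$ be nonzero (real or complex) constants, and let $\alpha$ be a (real or complex) constant with $\alpha\neq-1$ and $\alpha\ne-\beta-1$. Then $$\int x^\alpha \sinh(\eta x^\beta)\,dx=\frac{x^{\alpha+1}}{(\alpha+1)(\alpha+\beta+1)}\Bigl[\sinh(\eta x^\beta)\;{}_1F_2\Bigl(1; \frac{\alpha+\beta+1}{2\beta}, \frac{\alpha+2\beta+1}{2\beta}; \frac{\eta^2 x^{2\beta}}{4}\Bigr)- \beta\eta x^{\beta}\cosh(\eta x^\beta)\;{}_1F_2\Bigl(1; \frac{\alpha+2\beta+1}{2\beta}, \frac{\alpha+3\beta+1}{2\beta}; \frac{\eta^2 x^{2\beta}}{4}\Bigr)\Bigr]+C,$$ where $C$ is an arbitrary constant of integration.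
   Context: The hypergeometric function ${}_1F_2$ is ${}_1F_2(a;b,c;x)=\sum_{n=0}^{\infty}\frac{(a)_n}{(b)_n(c)_n}\frac{x^n}{n!}$, where $(\vartheta)_n=\Gamma(\vartheta+n)/\Gamma(\vartheta)$, $(\vartheta)_0=1$ (Pochhammer symbol). The integral is an indefinite integral (antiderivative) with respect to $x$.
   Formalization: The formula as printed is false (e.g. α=0, β=η=1); a factor (α+β+1) is inserted before the sinh term. Lower parameters of each 1F2 must not be non-positive integers, where it is undefined. Powers use a continuous log branch on a convex or open connected domain without 0. *)

theory Defs
  imports "HOL-Analysis.Analysis"
begin

(* At a lower parameter in the set of non-positive integers this series is not meaningful
   (division by zero is zero in HOL), so every use must exclude such parameters. *)
definition hypergeom_1F2 :: "complex \<Rightarrow> complex \<Rightarrow> complex \<Rightarrow> complex \<Rightarrow> complex" where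
  "hypergeom_1F2 a b c x =
     (\<Sum>n. pochhammer a n / (pochhammer b n * pochhammer c n) * (x ^ n / fact n))"

definition log_branch_on :: "(complex \<Rightarrow> complex) \<Rightarrow> complex set \<Rightarrow> bool" where
  "log_branch_on L S \<longleftrightarrow> continuous_on S L \<and> (\<forall>x\<in>S. exp (L x) = x)"

(* For L = Ln and nonzero x this is x powr a, hence the usual real power for positive real x and
   real a. For an integer a it is the integer power of x, whichever branch is chosen. Branches
   other than Ln are needed for regions that meet the negative real axis. *)
definition branch_power :: "(complex \<Rightarrow> complex) \<Rightarrow> complex \<Rightarrow> complex \<Rightarrow> complex" where
  "branch_power L x a = exp (a * L x)"

(* The derivative is taken within S. For an interval S on the real axis F is thus a
   complex-valued antiderivative in a real variable; for open S it is a complex primitive. *)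
definition antiderivative_on ::
    "(complex \<Rightarrow> complex) \<Rightarrow> (complex \<Rightarrow> complex) \<Rightarrow> complex set \<Rightarrow> bool" where
  "antiderivative_on F f S \<longleftrightarrow> (\<forall>x\<in>S. (F has_field_derivative f x) (at x within S))"

lemma log_branch_on_Ln: "S \<inter> \<real>\<^sub>\<le>\<^sub>0 = {} \<Longrightarrow> log_branch_on Ln S"
  by (auto simp: log_branch_on_def complex_nonpos_Reals_iff
      intro!: continuous_on_Ln continuous_on_id exp_Ln)

lemma branch_power_Ln: "x \<noteq> 0 \<Longrightarrow> branch_power Ln x a = x powr a"
  by (simp add: branch_power_def powr_def)

lemma branch_power_of_nat: "exp (L x) = x \<Longrightarrow> branch_power L x (of_nat n) = x ^ n"
  by (simp add: branch_power_def exp_of_nat_mult)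

end

theory Submission
  imports Defs
begin

text \<open>
  Put \<open>s = (\<alpha> + 1) / \<beta>\<close> and \<open>E s u = (\<Sum>n. u ^ n / (s + 1)\<^sub>n)\<close>, which is \<open>\<^sub>1F\<^sub>1(1; s + 1; u)\<close>.
  Comparing coefficients gives \<open>u E' = s + (u - s) E\<close>, so that \<open>x powr (\<alpha> + 1) / (\<alpha> + 1) * exp u * E s (- u)\<close>
  with \<open>u = \<eta> x powr \<beta>\<close> is a primitive of \<open>x powr \<alpha> * exp u\<close>. Half the difference of these primitives
  for \<open>\<eta>\<close> and \<open>- \<eta>\<close> is a primitive of the integrand. By the duplication formula
  \<open>(2 z)\<^sub>2\<^sub>n = 4 ^ n (z)\<^sub>n (z + 1/2)\<^sub>n\<close> the first \<open>\<^sub>1F\<^sub>2\<close> series is the even part of \<open>E s\<close>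
  and the second one, multiplied by \<open>u / (s + 1)\<close>, its odd part.
\<close>

section \<open>The Kummer series: convergence and differential equation\<close>

definition kummer_1F1_one :: "complex \<Rightarrow> complex \<Rightarrow> complex" where
  "kummer_1F1_one s u = (\<Sum>n. 1 / pochhammer (s + 1) n * u ^ n)"

lemma pochhammer_nonzero_complex:
  fixes z :: complex
  assumes "z \<notin> \<int>\<^sub>\<le>\<^sub>0"
  shows "pochhammer z n \<noteq> 0"
  using assms by (auto simp: pochhammer_eq_0_iff)

text \<open>The ratio of consecutive terms is \<open>u / (s + 1 + n)\<close>, which tends to 0; the
  hypothesis keeps every denominator nonzero.\<close>

lemma summable_kummer_1F1_one:
  fixes s u :: complex
  assumes s: "s + 1 \<notin> \<int>\<^sub>\<le>\<^sub>0"
  shows "summable (\<lambda>n. 1 / pochhammer (s + 1) n * u ^ n)"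
proof -
  \<comment> \<open>By the triangle inequality this N forces the norm of \<open>s + 1 + n\<close> to
    be at least \<open>2 * norm u\<close> for all n from N on, so the ratios are at most
    1/2.\<close>
  obtain N :: nat where N: "real N > norm (s + 1) + 2 * norm u"
    using reals_Archimedean2 by blast
  show ?thesis
  proof (rule summable_ratio_test[of "1/2" N])
    fix n assume n: "n \<ge> N"
    have nz: "s + 1 + of_nat n \<noteq> 0"
      using pochhammer_nonzero_complex[OF s, of "Suc n"] by (auto simp: pochhammer_Suc)
    have "real n = norm (s + 1 + of_nat n - (s + 1))"
      by simp
    also have "\<dots> \<le> norm (s + 1 + of_nat n) + norm (s + 1)"
      by (rule norm_triangle_ineq4)
    finally have "2 * norm u \<le> norm (s + 1 + of_nat n)"
      using N n by linarith
    then have "norm u / norm (s + 1 + of_nat n) \<le> 1 / 2"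
      using nz by (simp add: divide_simps)
    then have "norm u / norm (s + 1 + of_nat n) * norm (1 / pochhammer (s + 1) n * u ^ n)
        \<le> 1 / 2 * norm (1 / pochhammer (s + 1) n * u ^ n)"
      by (rule mult_right_mono) simp
    then show "norm (1 / pochhammer (s + 1) (Suc n) * u ^ Suc n)
        \<le> 1 / 2 * norm (1 / pochhammer (s + 1) n * u ^ n)"
      by (simp add: pochhammer_Suc norm_mult norm_divide norm_power mult_ac)
  qed simp
qed

text \<open>The coefficients satisfy (n + 1 + s) c_(n+1) = c_n; multiplying by u^(n+1) and summing
  gives the equation. It speaks of \<open>u * D\<close> instead of \<open>D\<close>, so u = 0 needs
  no separate treatment.\<close>

lemma kummer_1F1_one_has_field_derivative:
  assumes s: "s + 1 \<notin> \<int>\<^sub>\<le>\<^sub>0"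
  obtains D where "(kummer_1F1_one s has_field_derivative D) (at u)"
    and "u * D = s + (u - s) * kummer_1F1_one s u"
proof
  define c where "c n = 1 / pochhammer (s + 1) n" for n
  define D where "D = (\<Sum>n. diffs c n * u ^ n)"
  have sm: "summable (\<lambda>n. c n * x ^ n)" for x
    unfolding c_def by (rule summable_kummer_1F1_one[OF s])
  have E: "kummer_1F1_one s = (\<lambda>x. \<Sum>n. c n * x ^ n)"
    by (simp add: kummer_1F1_one_def c_def fun_eq_iff)
  show "(kummer_1F1_one s has_field_derivative D) (at u)"
    unfolding E D_def by (rule termdiffs_strong_converges_everywhere[OF sm])
  have c_rec: "(of_nat (Suc n) + s) * c (Suc n) = c n" for n
  proof -
    have "s + 1 + of_nat n \<noteq> 0"
      using pochhammer_nonzero_complex[OF s, of "Suc n"] by (auto simp: pochhammer_Suc)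
    then show ?thesis
      unfolding c_def pochhammer_Suc by (simp add: divide_simps add_ac)
  qed
  have "(\<lambda>n. diffs c n * u ^ n) sums D"
    unfolding D_def by (rule summable_sums[OF termdiff_converges_all[OF sm]])
  then have "(\<lambda>n. u * (diffs c n * u ^ n)) sums (u * D)"
    by (rule sums_mult)
  moreover have "(\<lambda>n. c n * u ^ n) sums kummer_1F1_one s u"
    unfolding E by (rule summable_sums[OF sm])
  \<comment> \<open>The index shift drops the term \<open>c 0 = 1\<close>, which becomes the
    constant s of the equation.\<close>
  then have "(\<lambda>n. s * (c (Suc n) * u ^ Suc n)) sums (s * (kummer_1F1_one s u - c 0))"
    using sums_Suc_iff[of "\<lambda>n. c n * u ^ n"] by (intro sums_mult) simp
  ultimately have "(\<lambda>n. u * (diffs c n * u ^ n) + s * (c (Suc n) * u ^ Suc n))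
      sums (u * D + s * (kummer_1F1_one s u - c 0))"
    by (rule sums_add)
  moreover have "u * (diffs c n * u ^ n) + s * (c (Suc n) * u ^ Suc n) = u * (c n * u ^ n)" for n
    unfolding c_rec[of n, symmetric] by (simp add: diffs_def algebra_simps)
  moreover have "(\<lambda>n. u * (c n * u ^ n)) sums (u * kummer_1F1_one s u)"
    unfolding E by (intro sums_mult summable_sums[OF sm])
  ultimately have "u * D + s * (kummer_1F1_one s u - c 0) = u * kummer_1F1_one s u"
    using sums_unique2 by simp
  then show "u * D = s + (u - s) * kummer_1F1_one s u"
    by (simp add: c_def algebra_simps)
qed

section \<open>Even and odd parts of the Kummer series\<close>

text \<open>\<open>pochhammer 1 n\<close> cancels \<open>fact n\<close>, and the 4^n of the
  duplication formula is absorbed by the 4 below \<open>u\<^sup>2\<close>.\<close>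

lemma hypergeom_1F2_one_half_step:
  "hypergeom_1F2 1 z (z + 1 / 2) (u\<^sup>2 / 4) = (\<Sum>n. u ^ (2 * n) / pochhammer (2 * z) (2 * n))"
proof -
  have "pochhammer 1 n / (pochhammer z n * pochhammer (z + 1 / 2) n) * ((u\<^sup>2 / 4) ^ n / fact n)
      = u ^ (2 * n) / pochhammer (2 * z) (2 * n)" for n
    unfolding pochhammer_double power_mult power_divide
    by (simp add: pochhammer_fact[symmetric] mult_ac)
  then show ?thesis
    unfolding hypergeom_1F2_def by (simp only:)
qed

text \<open>Averaging over u and -u kills the odd powers; what remains is the half-step series at z
  = (s + 1) / 2.\<close>

lemma kummer_1F1_one_even_part:
  assumes s: "s + 1 \<notin> \<int>\<^sub>\<le>\<^sub>0"
  shows "hypergeom_1F2 1 ((s + 1) / 2) ((s + 2) / 2) (u\<^sup>2 / 4)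
    = (kummer_1F1_one s u + kummer_1F1_one s (- u)) / 2"
proof -
  let ?f = "\<lambda>n. (1 / pochhammer (s + 1) n * u ^ n + 1 / pochhammer (s + 1) n * (- u) ^ n) / 2"
  have "?f sums ((kummer_1F1_one s u + kummer_1F1_one s (- u)) / 2)"
    unfolding kummer_1F1_one_def
    by (intro sums_divide sums_add summable_sums summable_kummer_1F1_one s)
  moreover have "?f n = 0" if "n \<notin> range (\<lambda>n. 2 * n)" for n
  proof -
    have "odd n" using that by (auto elim: evenE)
    then show ?thesis by simp
  qed
  ultimately have "(\<lambda>n. ?f (2 * n)) sums ((kummer_1F1_one s u + kummer_1F1_one s (- u)) / 2)"
    using sums_mono_reindex[of "\<lambda>n. 2 * n" ?f] by (simp add: strict_mono_def)
  then have "(\<lambda>n. u ^ (2 * n) / pochhammer (s + 1) (2 * n))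
      sums ((kummer_1F1_one s u + kummer_1F1_one s (- u)) / 2)"
    by simp
  then show ?thesis
    using hypergeom_1F2_one_half_step[of "(s + 1) / 2" u] sums_unique[symmetric]
    by (simp add: add_divide_distrib add_ac)
qed

lemma kummer_1F1_one_odd_part:
  assumes s: "s + 1 \<notin> \<int>\<^sub>\<le>\<^sub>0"
  shows "u / (s + 1) * hypergeom_1F2 1 ((s + 2) / 2) ((s + 3) / 2) (u\<^sup>2 / 4)
    = (kummer_1F1_one s u - kummer_1F1_one s (- u)) / 2"
proof -
  let ?f = "\<lambda>n. (1 / pochhammer (s + 1) n * u ^ n - 1 / pochhammer (s + 1) n * (- u) ^ n) / 2"
  let ?d = "(kummer_1F1_one s u - kummer_1F1_one s (- u)) / 2"
  have nz: "s + 1 \<noteq> 0"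
    using s by auto
  have "?f sums ?d"
    unfolding kummer_1F1_one_def
    by (intro sums_divide sums_diff summable_sums summable_kummer_1F1_one s)
  moreover have "?f n = 0" if "n \<notin> range (\<lambda>n. 2 * n + 1)" for n
  proof -
    have "even n" using that by (metis oddE rangeI)
    then show ?thesis by simp
  qed
  ultimately have "(\<lambda>n. ?f (2 * n + 1)) sums ?d"
    using sums_mono_reindex[of "\<lambda>n. 2 * n + 1" ?f] by (simp add: strict_mono_def)
  \<comment> \<open>Splitting off the first factor, (s+1)_(2n+1) = (s + 1) (s+2)_(2n): this is the
    origin of the prefactor and of the raised lower parameters.\<close>
  moreover have "?f (2 * n + 1) = u / (s + 1) * (u ^ (2 * n) / pochhammer (s + 2) (2 * n))" for n
    using nz by (simp add: pochhammer_rec add_ac mult_ac)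
  ultimately have "(\<lambda>n. u / (s + 1) * (u ^ (2 * n) / pochhammer (s + 2) (2 * n))) sums ?d"
    by (simp only:)
  \<comment> \<open>Cancelling the prefactor yields the value of the bare series only for nonzero u;
    at u = 0 both sides of the claim vanish.\<close>
  then have "(\<lambda>n. (s + 1) / u * (u / (s + 1) * (u ^ (2 * n) / pochhammer (s + 2) (2 * n))))
      sums ((s + 1) / u * ?d)"
    by (rule sums_mult)
  then have "(\<lambda>n. u ^ (2 * n) / pochhammer (s + 2) (2 * n)) sums ((s + 1) / u * ?d)" if "u \<noteq> 0"
    using that nz by simp
  then have "(\<Sum>n. u ^ (2 * n) / pochhammer (s + 2) (2 * n)) = (s + 1) / u * ?d" if "u \<noteq> 0"
    using that sums_unique by metis
  moreover have "hypergeom_1F2 1 ((s + 2) / 2) ((s + 3) / 2) (u\<^sup>2 / 4)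
      = (\<Sum>n. u ^ (2 * n) / pochhammer (s + 2) (2 * n))"
    using hypergeom_1F2_one_half_step[of "(s + 2) / 2" u] by (simp add: add_divide_distrib add_ac)
  ultimately show ?thesis
    using nz by (cases "u = 0") (simp_all only:, simp_all)
qed

section \<open>Differentiation along a branch of the logarithm\<close>

text \<open>Near x the branch equals \<open>L x + Ln (y / x)\<close>, and \<open>Ln\<close> is
  differentiable at 1. The comparison takes place inside S only, so S may be a real interval as well
  as an open set.\<close>

lemma log_branch_on_has_field_derivative:
  assumes L: "log_branch_on L S" and x: "x \<in> S"
  shows "(L has_field_derivative 1 / x) (at x within S)"
proof -
  have e: "exp (L y) = y" if "y \<in> S" for y
    using L that by (simp add: log_branch_on_def)
  have x0: "x \<noteq> 0"
    using e[OF x] by (metis exp_not_eq_zero)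
  have "(L \<longlongrightarrow> L x) (at x within S)"
    using L x by (simp add: log_branch_on_def continuous_on_def)
  \<comment> \<open>The bound pi puts \<open>Im (L y - L x)\<close> into the strip on which
    \<open>Ln\<close> inverts \<open>exp\<close>.\<close>
  then obtain d where d: "d > 0"
    "\<And>y. y \<in> S \<Longrightarrow> y \<noteq> x \<Longrightarrow> dist y x < d \<Longrightarrow> dist (L y) (L x) < pi"
    using pi_gt_zero unfolding tendsto_iff eventually_at by metis
  have "((\<lambda>y. L x + Ln (y / x)) has_field_derivative 1 / x) (at x within S)"
    using x0 by (auto intro!: derivative_eq_intros)
  then show ?thesis
  proof (rule has_field_derivative_transform_within[OF _ d(1) x])
    fix y assume y: "y \<in> S" "dist y x < d"
    have "norm (L y - L x) < pi"
      using d(2)[OF y(1) _ y(2)] by (cases "y = x") (auto simp: dist_norm)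
    then have "\<bar>Im (L y - L x)\<bar> < pi"
      using abs_Im_le_cmod[of "L y - L x"] by linarith
    then have "Ln (exp (L y - L x)) = L y - L x"
      by (intro Ln_exp) auto
    then show "L x + Ln (y / x) = L y"
      using e x y by (simp add: exp_diff)
  qed
qed

lemma branch_power_has_field_derivative:
  assumes "log_branch_on L S" and "x \<in> S"
  shows "((\<lambda>x. branch_power L x a) has_field_derivative a * branch_power L x a / x) (at x within S)"
  unfolding branch_power_def
  by (auto intro!: derivative_eq_intros log_branch_on_has_field_derivative[OF assms])

lemma branch_power_exp_antiderivative:
  fixes \<alpha> \<beta> \<eta> :: complex
  defines "s \<equiv> (\<alpha> + 1) / \<beta>"
  assumes \<beta>: "\<beta> \<noteq> 0" and \<alpha>: "\<alpha> \<noteq> - 1" and s: "s + 1 \<notin> \<int>\<^sub>\<le>\<^sub>0"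
    and L: "log_branch_on L S"
  shows "antiderivative_on
    (\<lambda>x. branch_power L x (\<alpha> + 1) / (\<alpha> + 1) * exp (\<eta> * branch_power L x \<beta>)
      * kummer_1F1_one s (- (\<eta> * branch_power L x \<beta>)))
    (\<lambda>x. branch_power L x \<alpha> * exp (\<eta> * branch_power L x \<beta>)) S"
  unfolding antiderivative_on_def
proof
  fix x assume x: "x \<in> S"
  define P where "P = branch_power L x (\<alpha> + 1)"
  define u where "u = \<eta> * branch_power L x \<beta>"
  define K where "K = kummer_1F1_one s (- u)"
  have ex: "exp (L x) = x"
    using L x by (simp add: log_branch_on_def)
  then have x0: "x \<noteq> 0"
    by (metis exp_not_eq_zero)
  have \<alpha>1: "\<alpha> + 1 \<noteq> 0"
    using \<alpha> by (simp add: add_eq_0_iff2)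
  have P: "P = x * branch_power L x \<alpha>"
    unfolding P_def branch_power_def by (simp add: distrib_right exp_add ex)
  obtain D where D: "(kummer_1F1_one s has_field_derivative D) (at (- u))"
    and ode: "- u * D = s + (- u - s) * K"
    unfolding K_def by (rule kummer_1F1_one_has_field_derivative[OF s])
  have dpow: "((\<lambda>x. branch_power L x a) has_field_derivative a * branch_power L x a / x)
      (at x within S)" for a
    by (rule branch_power_has_field_derivative[OF L x])
  have du: "((\<lambda>x. \<eta> * branch_power L x \<beta>) has_field_derivative \<beta> * u / x) (at x within S)"
    using DERIV_cmult[OF dpow[of \<beta>], of \<eta>] by (simp add: u_def mult_ac)
  have dK: "((\<lambda>x. kummer_1F1_one s (- (\<eta> * branch_power L x \<beta>))) has_field_derivative
      D * (- (\<beta> * u / x))) (at x within S)"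
    using D DERIV_minus[OF du] unfolding u_def by (rule DERIV_chain2)
  have "((\<lambda>x. branch_power L x (\<alpha> + 1) / (\<alpha> + 1) * exp (\<eta> * branch_power L x \<beta>)
      * kummer_1F1_one s (- (\<eta> * branch_power L x \<beta>))) has_field_derivative
      ((\<alpha> + 1) * P / x / (\<alpha> + 1) * exp u + exp u * (\<beta> * u / x) * (P / (\<alpha> + 1))) * K
        + D * (- (\<beta> * u / x)) * (P / (\<alpha> + 1) * exp u)) (at x within S)"
    unfolding P_def u_def K_def
    by (intro DERIV_mult DERIV_cdivide dpow dK[unfolded u_def]
        DERIV_chain2[OF DERIV_exp du[unfolded u_def]])
  moreover have "(\<alpha> + 1) * P / x / (\<alpha> + 1) = P / x"
    using \<alpha>1 by simp
  then have "((\<alpha> + 1) * P / x / (\<alpha> + 1) * exp u + exp u * (\<beta> * u / x) * (P / (\<alpha> + 1))) * K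
        + D * (- (\<beta> * u / x)) * (P / (\<alpha> + 1) * exp u)
      = P * exp u / x * (K + \<beta> / (\<alpha> + 1) * (u * K + - u * D))"
    by (simp add: algebra_simps)
  \<comment> \<open>The differential equation at -u eliminates D. Since \<beta> / (\<alpha> + 1) is
    1 / s, the bracket above becomes K + (1 - K) = 1, leaving the integrand P * exp u / x.\<close>
  moreover have "u * K + - u * D = s * (1 - K)"
    unfolding ode by (simp add: algebra_simps)
  moreover have "\<beta> / (\<alpha> + 1) * (s * (1 - K)) = 1 - K"
    using \<alpha>1 \<beta> by (simp add: s_def)
  ultimately show "((\<lambda>x. branch_power L x (\<alpha> + 1) / (\<alpha> + 1) * exp (\<eta> * branch_power L x \<beta>)
      * kummer_1F1_one s (- (\<eta> * branch_power L x \<beta>))) has_field_derivative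
      branch_power L x \<alpha> * exp (\<eta> * branch_power L x \<beta>)) (at x within S)"
    using x0 by (simp add: P u_def)
qed

section \<open>Uniqueness up to a constant\<close>

text \<open>The difference of two primitives has derivative 0 within S. Convexity covers real
  intervals; on open connected sets the derivative within S is the ordinary one.\<close>

lemma antiderivative_on_iff_eq_plus_constant:
  assumes G: "antiderivative_on G f S" and S: "convex S \<or> open S \<and> connected S"
  shows "antiderivative_on F f S \<longleftrightarrow> (\<exists>C. \<forall>x\<in>S. F x = G x + C)"
proof
  assume "antiderivative_on F f S"
  then have D: "((\<lambda>x. F x - G x) has_field_derivative 0) (at x within S)" if "x \<in> S" for x
    using that G DERIV_diff unfolding antiderivative_on_def by fastforce
  have "\<exists>C. \<forall>x\<in>S. F x - G x = C"
    using S
  proof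
    assume "convex S"
    then show ?thesis
      using has_field_derivative_zero_constant[OF _ D] by metis
  next
    assume S: "open S \<and> connected S"
    then have "(\<lambda>x. F x - G x) constant_on S"
      using D at_within_open by (intro has_field_derivative_0_imp_constant_on) fastforce+
    then show ?thesis
      by (simp add: constant_on_def)
  qed
  then show "\<exists>C. \<forall>x\<in>S. F x = G x + C"
    by (metis add.commute diff_add_cancel)
next
  assume "\<exists>C. \<forall>x\<in>S. F x = G x + C"
  then obtain C where C: "F x = G x + C" if "x \<in> S" for x
    by blast
  show "antiderivative_on F f S"
    unfolding antiderivative_on_def
  proof
    fix x assume x: "x \<in> S"
    have "((\<lambda>x. G x + C) has_field_derivative f x) (at x within S)"
      using G x unfolding antiderivative_on_def by (auto intro!: derivative_eq_intros)
    then show "(F has_field_derivative f x) (at x within S)"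
      by (rule has_field_derivative_transform_within[OF _ zero_less_one x]) (simp add: C)
  qed
qed

(* The factor (\<alpha> + \<beta> + 1) in front of sinh is missing in the printed formula, which is false
   without it (e.g. for \<alpha> = 0, \<beta> = \<eta> = 1). *)
theorem proposition3:
  fixes \<alpha> \<beta> \<eta> :: complex and L F :: "complex \<Rightarrow> complex" and S :: "complex set"
  assumes "\<eta> \<noteq> 0" and "\<beta> \<noteq> 0" and "\<alpha> \<noteq> - 1" and "\<alpha> \<noteq> - \<beta> - 1"
    and "(\<alpha> + \<beta> + 1) / (2 * \<beta>) \<notin> \<int>\<^sub>\<le>\<^sub>0"
    and "(\<alpha> + 2 * \<beta> + 1) / (2 * \<beta>) \<notin> \<int>\<^sub>\<le>\<^sub>0"
    and "(\<alpha> + 3 * \<beta> + 1) / (2 * \<beta>) \<notin> \<int>\<^sub>\<le>\<^sub>0"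
    and "log_branch_on L S"
    and "convex S \<or> open S \<and> connected S"
  shows "antiderivative_on F (\<lambda>x. branch_power L x \<alpha> * sinh (\<eta> * branch_power L x \<beta>)) S \<longleftrightarrow>
    (\<exists>C. \<forall>x\<in>S. F x =
       branch_power L x (\<alpha> + 1) / ((\<alpha> + 1) * (\<alpha> + \<beta> + 1)) *
       ((\<alpha> + \<beta> + 1) * sinh (\<eta> * branch_power L x \<beta>) *
          hypergeom_1F2 1 ((\<alpha> + \<beta> + 1) / (2 * \<beta>)) ((\<alpha> + 2 * \<beta> + 1) / (2 * \<beta>))
            (\<eta>\<^sup>2 * branch_power L x (2 * \<beta>) / 4)
        - \<beta> * \<eta> * branch_power L x \<beta> * cosh (\<eta> * branch_power L x \<beta>) *
          hypergeom_1F2 1 ((\<alpha> + 2 * \<beta> + 1) / (2 * \<beta>)) ((\<alpha> + 3 * \<beta> + 1) / (2 * \<beta>))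
            (\<eta>\<^sup>2 * branch_power L x (2 * \<beta>) / 4))
       + C)"
proof -
  define s where "s = (\<alpha> + 1) / \<beta>"
  have params: "(\<alpha> + \<beta> + 1) / (2 * \<beta>) = (s + 1) / 2" "(\<alpha> + 2 * \<beta> + 1) / (2 * \<beta>) = (s + 2) / 2"
    "(\<alpha> + 3 * \<beta> + 1) / (2 * \<beta>) = (s + 3) / 2"
    using assms(2) by (simp_all add: s_def field_simps)
  \<comment> \<open>If s + 1 = -k, then an even k makes (s + 1) / 2 a non-positive integer and an
    odd k does so for (s + 2) / 2; both are excluded lower parameters.\<close>
  have s: "s + 1 \<notin> \<int>\<^sub>\<le>\<^sub>0"
  proof
    assume "s + 1 \<in> \<int>\<^sub>\<le>\<^sub>0"
    then obtain k where k: "s + 1 = - of_nat k"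
      by (elim nonpos_Ints_cases')
    show False
    proof (cases "even k")
      case True
      then obtain m where "k = 2 * m" by (elim evenE)
      then have "(s + 1) / 2 = - of_nat m" using k by simp
      then show False using assms(5) unfolding params by simp
    next
      case False
      then obtain m where "k = 2 * m + 1" by (elim oddE)
      then have "s + 2 = 2 * - of_nat m" using k by (simp add: eq_neg_iff_add_eq_0 algebra_simps)
      then have "(s + 2) / 2 = - of_nat m" by simp
      then show False using assms(6) unfolding params by simp
    qed
  qed
  have \<alpha>\<beta>1: "\<alpha> + \<beta> + 1 \<noteq> 0"
    using assms(4) by (simp only: eq_diff_eq eq_neg_iff_add_eq_0 add_ac not_False_eq_True)
  define K where "K h x = branch_power L x (\<alpha> + 1) / (\<alpha> + 1) * exp (h * branch_power L x \<beta>)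
      * kummer_1F1_one s (- (h * branch_power L x \<beta>))" for h x
  have K: "antiderivative_on (K h) (\<lambda>x. branch_power L x \<alpha> * exp (h * branch_power L x \<beta>)) S" for h
    using branch_power_exp_antiderivative[OF assms(2,3) _ assms(8)] s
    unfolding K_def s_def by blast
  have "antiderivative_on (\<lambda>x. (K \<eta> x - K (- \<eta>) x) / 2)
      (\<lambda>x. (branch_power L x \<alpha> * exp (\<eta> * branch_power L x \<beta>)
        - branch_power L x \<alpha> * exp (- \<eta> * branch_power L x \<beta>)) / 2) S"
    using K unfolding antiderivative_on_def by (intro ballI DERIV_cdivide DERIV_diff) blast+
  then have "antiderivative_on (\<lambda>x. (K \<eta> x - K (- \<eta>) x) / 2)
      (\<lambda>x. branch_power L x \<alpha> * sinh (\<eta> * branch_power L x \<beta>)) S"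
    by (simp add: sinh_field_def right_diff_distrib)
  moreover have "(K \<eta> x - K (- \<eta>) x) / 2 =
      branch_power L x (\<alpha> + 1) / ((\<alpha> + 1) * (\<alpha> + \<beta> + 1)) *
       ((\<alpha> + \<beta> + 1) * sinh (\<eta> * branch_power L x \<beta>) *
          hypergeom_1F2 1 ((\<alpha> + \<beta> + 1) / (2 * \<beta>)) ((\<alpha> + 2 * \<beta> + 1) / (2 * \<beta>))
            (\<eta>\<^sup>2 * branch_power L x (2 * \<beta>) / 4)
        - \<beta> * \<eta> * branch_power L x \<beta> * cosh (\<eta> * branch_power L x \<beta>) *
          hypergeom_1F2 1 ((\<alpha> + 2 * \<beta> + 1) / (2 * \<beta>)) ((\<alpha> + 3 * \<beta> + 1) / (2 * \<beta>))
            (\<eta>\<^sup>2 * branch_power L x (2 * \<beta>) / 4))" (is "_ = ?rhs") for x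
  proof -
    define P where "P = branch_power L x (\<alpha> + 1) / (\<alpha> + 1)"
    define u where "u = \<eta> * branch_power L x \<beta>"
    define A where "A = hypergeom_1F2 1 ((s + 1) / 2) ((s + 2) / 2) (u\<^sup>2 / 4)"
    define B where "B = hypergeom_1F2 1 ((s + 2) / 2) ((s + 3) / 2) (u\<^sup>2 / 4)"
    have "branch_power L x (2 * \<beta>) = (branch_power L x \<beta>)\<^sup>2"
      unfolding branch_power_def by (simp add: exp_double[symmetric] mult.assoc)
    then have u2: "\<eta>\<^sup>2 * branch_power L x (2 * \<beta>) = u\<^sup>2"
      by (simp add: u_def power_mult_distrib)
    have "?rhs = P / (\<alpha> + \<beta> + 1) * ((\<alpha> + \<beta> + 1) * sinh u * A - \<beta> * u * cosh u * B)"
      unfolding params u2 A_def B_def P_def u_def by (simp add: mult_ac)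
    also have "\<dots> = P * (sinh u * A - cosh u * (\<beta> / (\<alpha> + \<beta> + 1) * u * B))"
      using \<alpha>\<beta>1 by (simp add: divide_simps)
    \<comment> \<open>Here \<alpha> + \<beta> + 1 = \<beta> (s + 1), so the cosh term acquires
      exactly the prefactor of the odd part.\<close>
    also have "\<beta> / (\<alpha> + \<beta> + 1) = 1 / (s + 1)"
      using assms(2) by (simp add: s_def field_simps)
    also have "1 / (s + 1) * u * B = (kummer_1F1_one s u - kummer_1F1_one s (- u)) / 2"
      unfolding B_def using kummer_1F1_one_odd_part[OF s, of u] by simp
    also have "A = (kummer_1F1_one s u + kummer_1F1_one s (- u)) / 2"
      unfolding A_def by (rule kummer_1F1_one_even_part[OF s])
    \<comment> \<open>Collecting by series value, E(-u) gets (sinh u + cosh u) / 2 = exp u / 2 and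
      E(u) gets (sinh u - cosh u) / 2 = -exp (-u) / 2.\<close>
    also have "P * (sinh u * ((kummer_1F1_one s u + kummer_1F1_one s (- u)) / 2)
        - cosh u * ((kummer_1F1_one s u - kummer_1F1_one s (- u)) / 2))
      = (P * exp u * kummer_1F1_one s (- u)
          - P * exp (- u) * kummer_1F1_one s u) / 2"
      unfolding sinh_field_def cosh_field_def by (simp add: field_simps)
    also have "\<dots> = (K \<eta> x - K (- \<eta>) x) / 2"
      by (simp add: K_def P_def u_def)
    finally show ?thesis ..
  qed
  ultimately show ?thesis
    using antiderivative_on_iff_eq_plus_constant[OF _ assms(9)] by simp
qed

end
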